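(* Let $\Phi:M_d(\mathbb C)\to M_d(\mathbb C)$ be completely positive and preserve the full-rank diagonal state $\gamma=\sum_i\gamma_i|i\rangle\langle i|$, i.e. $\Phi(\gamma)=\gamma$. For two output basis labels $r\ne s$ define, for every $i$, $$q_i:=\gamma_i\langle r|\Phi(|i\rangle\langle i|)|s\rangle,\qquad b_i:=\gamma_i\sqrt{p(r|i)p(s|i)},$$ where $p(r|i):=\langle r|\Phi(|i\rangle\langle i|)|r\rangle$. Then $$|q_i|\le b_i\ \text{ for every } i,\qquad \sum_i q_i=0 .$$ If, for fixed transition probabilities $p(r|i),p(s|i)$, there exists an input basis label $i_0$ such that $$b_{i_0}>\sum_{i\ne i_0}b_i,$$ then no completely positive map preserving $\gamma$ with these transition probabilities can simultaneously saturate (satisfy with equality for all $i$) the elementary bounds $$\bigl|\langle r|\Phi(|i\rangle\langle i|)|s\rangle\bigr|\le\sqrt{p(r|i)p(s|i)} .$$ In particular (when $\gamma$ is the Gibbs state of the system Hamiltonian), the same saturation pattern is impossible for every covariant Gibbs-preserving CPTP map and every thermal operation.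
   Context: $\{|i\rangle\}_{i=1}^d$ is a fixed orthonormal basis of $\mathbb C^d$. For a system Hamiltonian $H_S$ diagonal in this basis, the Gibbs state is $\gamma=e^{-\beta H_S}/\mathrm{Tr}(e^{-\beta H_S})$. A covariant Gibbs-preserving map is a CPTP map $\Phi$ with $\Phi(\gamma)=\gamma$ and $\Phi(e^{-itH_S}Xe^{itH_S})=e^{-itH_S}\Phi(X)e^{itH_S}$ for all $X$ and $t\in\mathbb R$. A thermal operation is a map $\Phi(\rho)=\mathrm{Tr}_B[U(\rho\otimes\tau_B)U^\dagger]$ with a finite-dimensional bath, $\tau_B=e^{-\beta H_B}/\mathrm{Tr}(e^{-\beta H_B})$, and $U$ unitary with $[U,H_S+H_B]=0$. *)

theory Defs
  imports
    "Jordan_Normal_Form.Matrix"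
    "Jordan_Normal_Form.Schur_Decomposition"
    "Jordan_Normal_Form.DL_Rank"
begin

text \<open>
  Basis labels are the naturals below the dimension. Maps on d-by-d matrices are functions on
  \<^typ>\<open>complex mat\<close> of which only the restriction to \<^term>\<open>carrier_mat d d\<close> matters.
\<close>

definition ket_bra :: "nat \<Rightarrow> nat \<Rightarrow> nat \<Rightarrow> complex mat" where
  "ket_bra d i j = mat d d (\<lambda>(a, b). if a = i \<and> b = j then 1 else 0)"

definition mat_trace :: "complex mat \<Rightarrow> complex" where
  "mat_trace A = (\<Sum>i<dim_row A. A $$ (i, i))"

definition hermitian_mat :: "nat \<Rightarrow> complex mat \<Rightarrow> bool" where
  "hermitian_mat n A \<longleftrightarrow> A \<in> carrier_mat n n \<and> mat_adjoint A = A"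

definition unitary_mat :: "nat \<Rightarrow> complex mat \<Rightarrow> bool" where
  "unitary_mat n U \<longleftrightarrow> U \<in> carrier_mat n n \<and>
     U * mat_adjoint U = 1\<^sub>m n \<and> mat_adjoint U * U = 1\<^sub>m n"

text \<open>
  The order on \<^typ>\<open>complex\<close> is the one under which \<^term>\<open>0 \<le> z\<close> says that z is real and
  nonnegative; hence the condition below includes hermiticity.
\<close>

definition psd_mat :: "nat \<Rightarrow> complex mat \<Rightarrow> bool" where
  "psd_mat n A \<longleftrightarrow> A \<in> carrier_mat n n \<and>
     (\<forall>v \<in> carrier_vec n. 0 \<le> (A *\<^sub>v v) \<bullet>c v)"

definition density_mat :: "nat \<Rightarrow> complex mat \<Rightarrow> bool" where
  "density_mat n A \<longleftrightarrow> psd_mat n A \<and> mat_trace A = 1"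

text \<open>The exponential series, summed entrywise (it converges for every square matrix).\<close>

definition mat_exp :: "complex mat \<Rightarrow> complex mat" where
  "mat_exp A = mat (dim_row A) (dim_row A)
     (\<lambda>(i, j). \<Sum>k. (A ^\<^sub>m k) $$ (i, j) / fact k)"

definition gibbs_state :: "real \<Rightarrow> complex mat \<Rightarrow> complex mat" where
  "gibbs_state \<beta> H =
     (let E = mat_exp (complex_of_real (- \<beta>) \<cdot>\<^sub>m H) in (1 / mat_trace E) \<cdot>\<^sub>m E)"

text \<open>
  The basis vector of a tensor product with labels (i, k), where k ranges below m, has index
  \<^term>\<open>i * m + k :: nat\<close>.
\<close>

definition tensor_mat :: "complex mat \<Rightarrow> complex mat \<Rightarrow> complex mat" where
  "tensor_mat A B = mat (dim_row A * dim_row B) (dim_col A * dim_col B)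
     (\<lambda>(i, j). A $$ (i div dim_row B, j div dim_col B) * B $$ (i mod dim_row B, j mod dim_col B))"

definition partial_trace_snd :: "nat \<Rightarrow> nat \<Rightarrow> complex mat \<Rightarrow> complex mat" where
  "partial_trace_snd d m X = mat d d (\<lambda>(i, j). \<Sum>k<m. X $$ (i * m + k, j * m + k))"

definition linear_mat_map :: "nat \<Rightarrow> (complex mat \<Rightarrow> complex mat) \<Rightarrow> bool" where
  "linear_mat_map d \<Phi> \<longleftrightarrow>
     (\<forall>X \<in> carrier_mat d d. \<Phi> X \<in> carrier_mat d d) \<and>
     (\<forall>X \<in> carrier_mat d d. \<forall>Y \<in> carrier_mat d d. \<Phi> (X + Y) = \<Phi> X + \<Phi> Y) \<and>
     (\<forall>c. \<forall>X \<in> carrier_mat d d. \<Phi> (c \<cdot>\<^sub>m X) = c \<cdot>\<^sub>m \<Phi> X)"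

text \<open>
  The map id tensor \<open>\<Phi>\<close> on the tensor product of n-by-n and d-by-d matrices: \<open>\<Phi>\<close> is applied to
  each of the n * n blocks of size d-by-d.
\<close>

definition ampliation ::
    "nat \<Rightarrow> nat \<Rightarrow> (complex mat \<Rightarrow> complex mat) \<Rightarrow> complex mat \<Rightarrow> complex mat" where
  "ampliation n d \<Phi> X = mat (n * d) (n * d)
     (\<lambda>(i, j). \<Phi> (mat d d (\<lambda>(k, l). X $$ ((i div d) * d + k, (j div d) * d + l)))
                 $$ (i mod d, j mod d))"

definition completely_positive :: "nat \<Rightarrow> (complex mat \<Rightarrow> complex mat) \<Rightarrow> bool" where
  "completely_positive d \<Phi> \<longleftrightarrow> linear_mat_map d \<Phi> \<and>
     (\<forall>n X. psd_mat (n * d) X \<longrightarrow> psd_mat (n * d) (ampliation n d \<Phi> X))"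

definition trace_preserving :: "nat \<Rightarrow> (complex mat \<Rightarrow> complex mat) \<Rightarrow> bool" where
  "trace_preserving d \<Phi> \<longleftrightarrow> (\<forall>X \<in> carrier_mat d d. mat_trace (\<Phi> X) = mat_trace X)"

definition time_evolution :: "complex mat \<Rightarrow> real \<Rightarrow> complex mat" where
  "time_evolution H t = mat_exp ((- (\<i> * complex_of_real t)) \<cdot>\<^sub>m H)"

definition time_covariant ::
    "nat \<Rightarrow> complex mat \<Rightarrow> (complex mat \<Rightarrow> complex mat) \<Rightarrow> bool" where
  "time_covariant d H \<Phi> \<longleftrightarrow> (\<forall>X \<in> carrier_mat d d. \<forall>t.
     \<Phi> (time_evolution H t * X * time_evolution H (- t)) =
     time_evolution H t * \<Phi> X * time_evolution H (- t))"

definition covariant_gibbs_preserving ::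
    "nat \<Rightarrow> real \<Rightarrow> complex mat \<Rightarrow> (complex mat \<Rightarrow> complex mat) \<Rightarrow> bool" where
  "covariant_gibbs_preserving d \<beta> H \<Phi> \<longleftrightarrow>
     completely_positive d \<Phi> \<and> trace_preserving d \<Phi> \<and>
     \<Phi> (gibbs_state \<beta> H) = gibbs_state \<beta> H \<and> time_covariant d H \<Phi>"

definition thermal_operation ::
    "nat \<Rightarrow> real \<Rightarrow> complex mat \<Rightarrow> (complex mat \<Rightarrow> complex mat) \<Rightarrow> bool" where
  "thermal_operation d \<beta> H \<Phi> \<longleftrightarrow> (\<exists>m H\<^sub>B U.
     m > 0 \<and> hermitian_mat m H\<^sub>B \<and> unitary_mat (d * m) U \<and>
     (let H\<^sub>t\<^sub>o\<^sub>t = tensor_mat H (1\<^sub>m m) + tensor_mat (1\<^sub>m d) H\<^sub>B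
      in U * H\<^sub>t\<^sub>o\<^sub>t = H\<^sub>t\<^sub>o\<^sub>t * U) \<and>
     (\<forall>\<rho> \<in> carrier_mat d d.
        \<Phi> \<rho> = partial_trace_snd d m
                 (U * tensor_mat \<rho> (gibbs_state \<beta> H\<^sub>B) * mat_adjoint U)))"

text \<open>
  The transition probability p(r|i). The diagonal entry is real and nonnegative for positive maps.
\<close>

definition trans_prob :: "nat \<Rightarrow> (complex mat \<Rightarrow> complex mat) \<Rightarrow> nat \<Rightarrow> nat \<Rightarrow> real" where
  "trans_prob d \<Phi> r i = Re (\<Phi> (ket_bra d i i) $$ (r, r))"

definition coherence_q ::
    "nat \<Rightarrow> complex mat \<Rightarrow> (complex mat \<Rightarrow> complex mat) \<Rightarrow> nat \<Rightarrow> nat \<Rightarrow> nat \<Rightarrow> complex" where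
  "coherence_q d \<gamma> \<Phi> r s i = \<gamma> $$ (i, i) * \<Phi> (ket_bra d i i) $$ (r, s)"

definition bound_b ::
    "complex mat \<Rightarrow> (nat \<Rightarrow> nat \<Rightarrow> real) \<Rightarrow> nat \<Rightarrow> nat \<Rightarrow> nat \<Rightarrow> real" where
  "bound_b \<gamma> p r s i = Re (\<gamma> $$ (i, i)) * sqrt (p r i * p s i)"

definition has_trans_probs ::
    "nat \<Rightarrow> (nat \<Rightarrow> nat \<Rightarrow> real) \<Rightarrow> nat \<Rightarrow> nat \<Rightarrow> (complex mat \<Rightarrow> complex mat) \<Rightarrow> bool" where
  "has_trans_probs d p r s \<Phi> \<longleftrightarrow>
     (\<forall>i<d. trans_prob d \<Phi> r i = p r i \<and> trans_prob d \<Phi> s i = p s i)"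

definition saturates ::
    "nat \<Rightarrow> (nat \<Rightarrow> nat \<Rightarrow> real) \<Rightarrow> nat \<Rightarrow> nat \<Rightarrow> (complex mat \<Rightarrow> complex mat) \<Rightarrow> bool" where
  "saturates d p r s \<Phi> \<longleftrightarrow>
     (\<forall>i<d. cmod (\<Phi> (ket_bra d i i) $$ (r, s)) = sqrt (p r i * p s i))"

end

theory Submission
  imports Defs
begin

text \<open>
  A positive matrix A satisfies \<open>\<bar>A\<^sub>r\<^sub>s\<bar>\<^sup>2 \<le> A\<^sub>r\<^sub>r A\<^sub>s\<^sub>s\<close>, which bounds each \<open>q\<^sub>i\<close>, and expanding
  \<open>\<Phi>(\<gamma>) = \<gamma>\<close> in the entry (r, s) gives \<open>\<Sum> q\<^sub>i = 0\<close>. Saturation turns \<open>\<bar>q\<^sub>i\<bar>\<close> into \<open>b\<^sub>i\<close>, so no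
  \<open>b\<^sub>i\<close> can exceed the sum of the others; this step only uses that \<open>\<Phi>\<close> is linear and
  \<open>\<Phi>(\<gamma>)\<^sub>r\<^sub>s = 0\<close>. A thermal operation is linear and maps the Gibbs state to a multiple of it: the exponential of
  \<open>H\<^sub>S \<otimes> 1 + 1 \<otimes> H\<^sub>B\<close> factorises over the tensor product, so U commutes with \<open>\<gamma> \<otimes> \<tau>\<^sub>B\<close>.
\<close>

section \<open>Positive matrices and completely positive maps\<close>

text \<open>A vector supported on two labels sees only the 2-by-2 principal submatrix at
  \<open>r\<close> and \<open>s\<close>, so positivity of \<open>A\<close> passes to that
  submatrix.\<close>

lemma scalar_prod_two_entries:
  fixes A :: "complex mat" and x y :: complex
  assumes A: "A \<in> carrier_mat d d" and r: "r < d" and s: "s < d" and rs: "r \<noteq> s"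
  defines "v \<equiv> vec d (\<lambda>k. if k = r then x else if k = s then y else 0)"
  shows "(A *\<^sub>v v) \<bullet>c v =
    (A $$ (r, r) * x + A $$ (r, s) * y) * cnj x + (A $$ (s, r) * x + A $$ (s, s) * y) * cnj y"
proof -
  have two: "(\<Sum>k\<in>{0..<d}. if k = r then f k else if k = s then g k else (0::complex)) = f r + g s"
    for f g
  proof -
    have "(\<Sum>k\<in>{0..<d}. if k = r then f k else if k = s then g k else 0) =
        (\<Sum>k\<in>{r, s}. if k = r then f k else if k = s then g k else 0)"
      by (rule sum.mono_neutral_right) (use r s in auto)
    then show ?thesis using rs by simp
  qed
  have row: "(A *\<^sub>v v) $ i = A $$ (i, r) * x + A $$ (i, s) * y" if "i < d" for i
  proof -
    have "(A *\<^sub>v v) $ i = (\<Sum>k\<in>{0..<d}. if k = r then A $$ (i, k) * x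
        else if k = s then A $$ (i, k) * y else 0)"
      using A that by (auto simp: v_def scalar_prod_def intro!: sum.cong)
    then show ?thesis by (simp add: two)
  qed
  have "(A *\<^sub>v v) \<bullet>c v = (\<Sum>k\<in>{0..<d}. if k = r then (A *\<^sub>v v) $ k * cnj x
      else if k = s then (A *\<^sub>v v) $ k * cnj y else 0)"
    by (auto simp: v_def scalar_prod_def intro!: sum.cong)
  then show ?thesis using row r s by (simp add: two)
qed

lemma psd_mat_diag_nonneg:
  assumes "psd_mat d A" "i < d"
  shows "0 \<le> A $$ (i, i)"
proof -
  have A: "A \<in> carrier_mat d d" using assms by (simp add: psd_mat_def)
  have "0 \<le> (A *\<^sub>v unit_vec d i) \<bullet>c unit_vec d i"
    using assms by (simp add: psd_mat_def)
  also have "conjugate (unit_vec d i) = (unit_vec d i :: complex vec)"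
    by (rule eq_vecI) (simp_all add: unit_vec_def)
  also have "(A *\<^sub>v unit_vec d i) \<bullet> unit_vec d i = A $$ (i, i)"
    using A assms(2) by simp
  finally show ?thesis .
qed

text \<open>This is nonnegativity of the 2-by-2 principal minor, obtained by testing the quadratic
  form on suitable vectors supported on \<open>r\<close> and \<open>s\<close>.\<close>

lemma psd_mat_entry_bound:
  assumes psd: "psd_mat d A" and r: "r < d" and s: "s < d" and rs: "r \<noteq> s"
  shows "cmod (A $$ (r, s)) \<le> sqrt (Re (A $$ (r, r)) * Re (A $$ (s, s)))"
proof -
  have A: "A \<in> carrier_mat d d" using psd by (simp add: psd_mat_def)
  define a b where "a = Re (A $$ (r, r))" and "b = Re (A $$ (s, s))"
  define z where "z = A $$ (r, s)"
  have a: "A $$ (r, r) = complex_of_real a" "0 \<le> a"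
    and b: "A $$ (s, s) = complex_of_real b" "0 \<le> b"
    using psd_mat_diag_nonneg[OF psd r] psd_mat_diag_nonneg[OF psd s]
    by (auto simp: a_def b_def less_eq_complex_def complex_eq_iff)
  have form: "0 \<le> (a * x + z * y) * cnj x + (A $$ (s, r) * x + b * y) * cnj y" for x y :: complex
  proof -
    let ?v = "vec d (\<lambda>k. if k = r then x else if k = s then y else 0)"
    have "0 \<le> (A *\<^sub>v ?v) \<bullet>c ?v" using psd by (simp add: psd_mat_def)
    then show ?thesis
      unfolding scalar_prod_two_entries[OF A r s rs] a(1) b(1) z_def .
  qed
  \<comment> \<open>The form must be real: at (1, 1) this forces the imaginary parts of the two
    off-diagonal entries to cancel, and at (1, \<i>) it forces their real parts to agree.\<close>
  have herm: "A $$ (s, r) = cnj z"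
    using form[of 1 1] form[of 1 \<i>] by (auto simp: less_eq_complex_def complex_eq_iff)
  define n where "n = (cmod z)\<^sup>2"
  have n: "z * cnj z = complex_of_real n" "cnj z * z = complex_of_real n"
    by (simp_all add: n_def complex_norm_square mult.commute del: of_real_power)
  \<comment> \<open>Giving \<open>y\<close> the phase of \<open>- cnj z\<close> makes both cross
    terms real and equal, which leaves a real quadratic form in \<open>t\<close> and
    \<open>u\<close>.\<close>
  have quad: "0 \<le> a * t\<^sup>2 - 2 * t * u * n + b * u\<^sup>2 * n" for t u :: real
  proof -
    have "(a * t + z * (- (u * cnj z))) * cnj t
        + (cnj z * t + b * (- (u * cnj z))) * cnj (- (u * cnj z))
        = a * t\<^sup>2 - 2 * t * u * (z * cnj z) + b * u\<^sup>2 * (z * cnj z)"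
      by (simp add: algebra_simps power2_eq_square)
    also have "\<dots> = complex_of_real (a * t\<^sup>2 - 2 * t * u * n + b * u\<^sup>2 * n)"
      by (simp add: n)
    finally show ?thesis
      using form[of t "- (u * cnj z)"] by (simp add: herm less_eq_complex_def)
  qed
  have "n \<le> a * b"
  proof (cases "b = 0")
    case True
    show ?thesis
    proof (rule ccontr)
      assume "\<not> n \<le> a * b"
      then have "n > 0" using True by simp
      \<comment> \<open>With \<open>b = 0\<close> the form is affine in \<open>u\<close>; this
        choice of \<open>u\<close> pushes it below zero.\<close>
      then have "0 \<le> a - 2 * (a + 1)"
        using quad[of 1 "(a + 1) / n"] True by simp
      then show False using a(2) by simp
    qed
  next
    case False
    then have "b > 0" using b by simp
    \<comment> \<open>The ratio \<open>u / t = 1 / b\<close> minimises the form; taking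
      \<open>t = b\<close> and \<open>u = 1\<close> avoids the division.\<close>
    moreover have "0 \<le> b * (a * b - n)"
      using quad[of b 1] by (simp add: algebra_simps power2_eq_square)
    ultimately show ?thesis by (simp add: zero_le_mult_iff)
  qed
  then show ?thesis
    by (metis a_def b_def n_def z_def real_le_rsqrt)
qed

lemma psd_mat_ket_bra:
  assumes "i < d"
  shows "psd_mat d (ket_bra d i i)"
  unfolding psd_mat_def
proof (intro conjI ballI)
  fix v :: "complex vec" assume v: "v \<in> carrier_vec d"
  have row: "(ket_bra d i i *\<^sub>v v) $ k = (if k = i then v $ i else 0)" if "k < d" for k
  proof -
    have "(ket_bra d i i *\<^sub>v v) $ k = (\<Sum>l\<in>{0..<d}. (if k = i \<and> l = i then 1 else 0) * v $ l)"
      using v that by (simp add: ket_bra_def scalar_prod_def)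
    also have "\<dots> = (\<Sum>l\<in>{0..<d}. if l = i then (if k = i then v $ l else 0) else 0)"
      by (rule sum.cong) auto
    finally show ?thesis using assms by simp
  qed
  have "(ket_bra d i i *\<^sub>v v) \<bullet>c v = (\<Sum>k\<in>{0..<d}. (ket_bra d i i *\<^sub>v v) $ k * cnj (v $ k))"
    using v by (simp add: scalar_prod_def del: index_mult_mat_vec)
  also have "\<dots> = (\<Sum>k\<in>{0..<d}. if k = i then v $ i * cnj (v $ i) else 0)"
    by (rule sum.cong) (auto simp: row simp del: index_mult_mat_vec)
  finally show "0 \<le> (ket_bra d i i *\<^sub>v v) \<bullet>c v"
    using assms by (simp add: sum.delta less_eq_complex_def)
qed (simp add: ket_bra_def)

text \<open>The ampliation of size 1 has a single block, \<open>X\<close> itself, so it agrees with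
  \<Phi> on \<open>X\<close>.\<close>

lemma completely_positive_psd_mat:
  assumes cp: "completely_positive d \<Phi>" and X: "psd_mat d X"
  shows "psd_mat d (\<Phi> X)"
proof -
  have carrier: "X \<in> carrier_mat d d" "\<Phi> X \<in> carrier_mat d d"
    using cp X by (auto simp: completely_positive_def linear_mat_map_def psd_mat_def)
  have "mat d d (\<lambda>(k, l). X $$ (k, l)) = X"
    using carrier by (intro eq_matI) auto
  then have "ampliation 1 d \<Phi> X = \<Phi> X"
    using carrier by (intro eq_matI) (auto simp: ampliation_def)
  then show ?thesis
    using cp X unfolding completely_positive_def by (metis mult_1)
qed

section \<open>Linear maps fixing a diagonal state\<close>

text \<open>Expands \<Phi> over the diagonal matrix units. Since \<open>linear_mat_map\<close>
  speaks of sums of two matrices, \<gamma> is assembled one diagonal entry at a time through the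
  truncations \<open>D n\<close>.\<close>

lemma linear_mat_map_diagonal_entry:
  assumes lin: "linear_mat_map d \<Phi>" and \<gamma>: "\<gamma> \<in> carrier_mat d d" "diagonal_mat \<gamma>"
    and r: "r < d" and s: "s < d"
  shows "(\<Sum>i<d. coherence_q d \<gamma> \<Phi> r s i) = \<Phi> \<gamma> $$ (r, s)"
proof -
  define D where "D n = mat d d (\<lambda>(i, j). if i = j \<and> i < n then \<gamma> $$ (i, i) else 0)" for n
  have "\<Phi> (D n) $$ (r, s) = (\<Sum>i<n. coherence_q d \<gamma> \<Phi> r s i)" if "n \<le> d" for n
    using that
  proof (induction n)
    case 0
    \<comment> \<open>That \<Phi> sends zero to zero comes from homogeneity with the scalar
      0.\<close>
    have "D 0 = 0 \<cdot>\<^sub>m D 0" by (rule eq_matI) (auto simp: D_def)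
    moreover have "D 0 \<in> carrier_mat d d" by (simp add: D_def)
    ultimately have "\<Phi> (D 0) = 0 \<cdot>\<^sub>m \<Phi> (D 0)" "\<Phi> (D 0) \<in> carrier_mat d d"
      using lin unfolding linear_mat_map_def by metis+
    then have "\<Phi> (D 0) $$ (r, s) = 0"
      using r s by (metis carrier_matD index_smult_mat(1) mult_zero_left)
    then show ?case by simp
  next
    case (Suc n)
    have split: "D (Suc n) = D n + \<gamma> $$ (n, n) \<cdot>\<^sub>m ket_bra d n n"
      by (rule eq_matI) (auto simp: D_def ket_bra_def)
    have c: "D n \<in> carrier_mat d d" "ket_bra d n n \<in> carrier_mat d d"
      by (auto simp: D_def ket_bra_def)
    have "\<Phi> (D (Suc n)) = \<Phi> (D n) + \<gamma> $$ (n, n) \<cdot>\<^sub>m \<Phi> (ket_bra d n n)"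
      using lin c unfolding split linear_mat_map_def by simp
    moreover have "\<Phi> (D n) \<in> carrier_mat d d" "\<Phi> (ket_bra d n n) \<in> carrier_mat d d"
      using lin c by (auto simp: linear_mat_map_def)
    ultimately show ?case
      using Suc r s by (simp add: coherence_q_def)
  qed
  moreover have "D d = \<gamma>"
    using \<gamma> by (intro eq_matI) (auto simp: D_def diagonal_mat_def)
  ultimately show ?thesis by (metis order_refl)
qed

text \<open>Complex numbers with sum zero are the sides of a closed polygon, and no side exceeds the
  total length of the others. The hypothesis on the (r, s) entry covers maps that fix \<gamma> as
  well as maps that only rescale it.\<close>

lemma not_saturates_if_dominant_bound:
  assumes lin: "linear_mat_map d \<Phi>" and \<gamma>: "psd_mat d \<gamma>" "diagonal_mat \<gamma>"
    and rs: "r < d" "s < d" and zero: "\<Phi> \<gamma> $$ (r, s) = 0"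
    and i: "i < d" and dominant: "(\<Sum>j\<in>{..<d} - {i}. bound_b \<gamma> p r s j) < bound_b \<gamma> p r s i"
  shows "\<not> saturates d p r s \<Phi>"
proof
  assume sat: "saturates d p r s \<Phi>"
  have c: "\<gamma> \<in> carrier_mat d d" using \<gamma> by (simp add: psd_mat_def)
  \<comment> \<open>The diagonal entries of \<gamma> are nonnegative reals, so their moduli are the
    real parts used in \<open>bound_b\<close>.\<close>
  have norm_q: "cmod (coherence_q d \<gamma> \<Phi> r s j) = bound_b \<gamma> p r s j" if "j < d" for j
    using psd_mat_diag_nonneg[OF \<gamma>(1) that] sat that
    by (auto simp: coherence_q_def bound_b_def saturates_def norm_mult less_eq_complex_def cmod_eq_Re)
  have "(\<Sum>j<d. coherence_q d \<gamma> \<Phi> r s j) = 0"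
    using linear_mat_map_diagonal_entry[OF lin c \<gamma>(2) rs] zero by simp
  then have "coherence_q d \<gamma> \<Phi> r s i = - (\<Sum>j\<in>{..<d} - {i}. coherence_q d \<gamma> \<Phi> r s j)"
    using i by (simp add: sum.remove[of "{..<d}" i] eq_neg_iff_add_eq_0)
  then have "bound_b \<gamma> p r s i = cmod (\<Sum>j\<in>{..<d} - {i}. coherence_q d \<gamma> \<Phi> r s j)"
    using norm_q[OF i] by simp
  also have "\<dots> \<le> (\<Sum>j\<in>{..<d} - {i}. cmod (coherence_q d \<gamma> \<Phi> r s j))"
    by (rule norm_sum)
  also have "\<dots> = (\<Sum>j\<in>{..<d} - {i}. bound_b \<gamma> p r s j)"
    by (rule sum.cong) (auto simp: norm_q)
  finally show False using dominant by simp
qed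

section \<open>The matrix exponential\<close>

text \<open>Growth at most geometric in \<open>k\<close> lets the scalar exponential series dominate
  every entry of the matrix series.\<close>

lemma norm_pow_mat_entry_le:
  fixes A :: "complex mat"
  assumes A: "A \<in> carrier_mat n n" and ij: "i < n" "j < n"
  shows "cmod ((A ^\<^sub>m k) $$ (i, j)) \<le> (\<Sum>a<n. \<Sum>b<n. cmod (A $$ (a, b))) ^ k"
  using ij
proof (induction k arbitrary: j)
  case 0
  then show ?case using A by simp
next
  case (Suc k)
  let ?C = "\<Sum>a<n. \<Sum>b<n. cmod (A $$ (a, b))"
  have "(A ^\<^sub>m Suc k) $$ (i, j) = (\<Sum>l<n. (A ^\<^sub>m k) $$ (i, l) * A $$ (l, j))"
    using A Suc.prems by (simp add: scalar_prod_def lessThan_atLeast0)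
  also have "cmod \<dots> \<le> (\<Sum>l<n. cmod ((A ^\<^sub>m k) $$ (i, l)) * cmod (A $$ (l, j)))"
    by (rule order.trans[OF norm_sum]) (simp add: norm_mult)
  \<comment> \<open>Enlarging the modulus of \<open>A $$ (l, j)\<close> to the whole row sum makes
    the sum over \<open>l\<close> produce exactly one more factor \<open>?C\<close>.\<close>
  also have "\<dots> \<le> (\<Sum>l<n. ?C ^ k * (\<Sum>b<n. cmod (A $$ (l, b))))"
  proof (rule sum_mono)
    fix l assume "l \<in> {..<n}"
    moreover have "cmod (A $$ (l, j)) \<le> (\<Sum>b<n. cmod (A $$ (l, b)))"
      by (rule member_le_sum) (use Suc.prems in auto)
    ultimately show "cmod ((A ^\<^sub>m k) $$ (i, l)) * cmod (A $$ (l, j))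
        \<le> ?C ^ k * (\<Sum>b<n. cmod (A $$ (l, b)))"
      using Suc.IH[of l] Suc.prems
      by (intro mult_mono) (auto intro!: zero_le_power sum_nonneg)
  qed
  also have "\<dots> = ?C ^ Suc k"
    by (simp add: power_Suc2 del: power_Suc flip: sum_distrib_left)
  finally show ?case .
qed

text \<open>Absolute convergence is what the Cauchy product of two exponential series requires
  later.\<close>

lemma summable_norm_mat_exp:
  fixes A :: "complex mat"
  assumes "A \<in> carrier_mat n n" "i < n" "j < n"
  shows "summable (\<lambda>k. cmod ((A ^\<^sub>m k) $$ (i, j) / fact k))"
proof (rule summable_comparison_test')
  show "summable (\<lambda>k. inverse (fact k) * (\<Sum>a<n. \<Sum>b<n. cmod (A $$ (a, b))) ^ k)"
    by (rule summable_exp)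
  show "norm (cmod ((A ^\<^sub>m k) $$ (i, j) / fact k))
      \<le> inverse (fact k) * (\<Sum>a<n. \<Sum>b<n. cmod (A $$ (a, b))) ^ k" if "0 \<le> k" for k
    using norm_pow_mat_entry_le[OF assms, of k]
    by (simp add: norm_divide field_simps)
qed

lemma mat_exp_carrier [simp]: "A \<in> carrier_mat n n \<Longrightarrow> mat_exp A \<in> carrier_mat n n"
  by (simp add: mat_exp_def)

text \<open>Turns the infinite sum in the definition of \<open>mat_exp\<close> into a genuine limit,
  so that series can be compared by uniqueness of sums.\<close>

lemma mat_exp_sums:
  assumes "A \<in> carrier_mat n n" "i < n" "j < n"
  shows "(\<lambda>k. (A ^\<^sub>m k) $$ (i, j) / fact k) sums (mat_exp A $$ (i, j))"
  using summable_norm_cancel[OF summable_norm_mat_exp[OF assms]] assms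
  by (auto simp: mat_exp_def summable_sums)

lemma pow_mat_commute:
  fixes A :: "'a :: semiring_1 mat"
  assumes A: "A \<in> carrier_mat n n" and U: "U \<in> carrier_mat n n" and comm: "U * A = A * U"
  shows "U * A ^\<^sub>m k = A ^\<^sub>m k * U"
proof (induction k)
  case 0
  then show ?case using A U by simp
next
  case (Suc k)
  have P: "A ^\<^sub>m k \<in> carrier_mat n n" using A by simp
  have "U * A ^\<^sub>m Suc k = (A ^\<^sub>m k * U) * A"
    using assoc_mult_mat[OF U P A] Suc by simp
  also have "\<dots> = A ^\<^sub>m Suc k * U"
    using assoc_mult_mat[OF P U A] assoc_mult_mat[OF P A U] comm by simp
  finally show ?case .
qed

text \<open>An entry of either product is a finite combination of convergent series, hence itself a
  series; the two series agree term by term because \<open>U\<close> commutes with each power of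
  \<open>A\<close>.\<close>

lemma mat_exp_commute:
  assumes A: "A \<in> carrier_mat n n" and U: "U \<in> carrier_mat n n" and comm: "U * A = A * U"
  shows "U * mat_exp A = mat_exp A * U"
proof (rule eq_matI)
  fix i j assume "i < dim_row (mat_exp A * U)" "j < dim_col (mat_exp A * U)"
  then have ij: "i < n" "j < n" using A U by (auto simp: mat_exp_def)
  note c = mat_exp_carrier[OF A]
  have "(\<lambda>k. \<Sum>l<n. U $$ (i, l) * ((A ^\<^sub>m k) $$ (l, j) / fact k))
      sums (\<Sum>l<n. U $$ (i, l) * mat_exp A $$ (l, j))"
    by (intro sums_sum sums_mult mat_exp_sums[OF A]) (use ij in auto)
  moreover have "(\<lambda>k. \<Sum>l<n. (A ^\<^sub>m k) $$ (i, l) / fact k * U $$ (l, j))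
      sums (\<Sum>l<n. mat_exp A $$ (i, l) * U $$ (l, j))"
    by (intro sums_sum sums_mult2 mat_exp_sums[OF A]) (use ij in auto)
  moreover have "(\<Sum>l<n. U $$ (i, l) * ((A ^\<^sub>m k) $$ (l, j) / fact k))
      = (\<Sum>l<n. (A ^\<^sub>m k) $$ (i, l) / fact k * U $$ (l, j))" for k
  proof -
    have "(U * A ^\<^sub>m k) $$ (i, j) = (A ^\<^sub>m k * U) $$ (i, j)"
      by (simp add: pow_mat_commute[OF A U comm])
    then show ?thesis
      using A U ij
      by (simp add: scalar_prod_def lessThan_atLeast0 flip: sum_divide_distrib)
  qed
  ultimately have "(\<Sum>l<n. U $$ (i, l) * mat_exp A $$ (l, j))
      = (\<Sum>l<n. mat_exp A $$ (i, l) * U $$ (l, j))"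
    by (simp add: sums_unique2)
  then show "(U * mat_exp A) $$ (i, j) = (mat_exp A * U) $$ (i, j)"
    using A U ij carrier_matD[OF c] by (simp add: scalar_prod_def lessThan_atLeast0)
qed (use A U carrier_matD[OF mat_exp_carrier[OF A]] in auto)

section \<open>Tensor products\<close>

lemma tensor_mat_carrier [simp]:
  "A \<in> carrier_mat d d \<Longrightarrow> B \<in> carrier_mat m m \<Longrightarrow> tensor_mat A B \<in> carrier_mat (d * m) (d * m)"
  by (simp add: tensor_mat_def)

lemma pair_index_less:
  fixes i k d m :: nat
  assumes "i < d" "k < m"
  shows "i * m + k < d * m"
proof -
  have "i * m + k < Suc i * m" using assms by simp
  also have "\<dots> \<le> d * m" using assms by (intro mult_le_mono1) simp
  finally show ?thesis .
qed

lemma tensor_mat_index: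
  assumes "A \<in> carrier_mat d d" "B \<in> carrier_mat m m" "i < d" "j < d" "a < m" "b < m"
  shows "tensor_mat A B $$ (i * m + a, j * m + b) = A $$ (i, j) * B $$ (a, b)"
  using assms by (simp add: tensor_mat_def pair_index_less)

text \<open>Division with remainder by \<open>m\<close> recovers the two tensor labels from any
  index below \<open>d * m\<close>.\<close>

lemma tensor_mat_eqI:
  fixes X Y :: "complex mat"
  assumes X: "X \<in> carrier_mat (d * m) (d * m)" and Y: "Y \<in> carrier_mat (d * m) (d * m)"
    and eq: "\<And>i j a b. i < d \<Longrightarrow> j < d \<Longrightarrow> a < m \<Longrightarrow> b < m \<Longrightarrow>
      X $$ (i * m + a, j * m + b) = Y $$ (i * m + a, j * m + b)"
  shows "X = Y"
proof (rule eq_matI)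
  fix p q assume "p < dim_row Y" "q < dim_col Y"
  then have pq: "p < d * m" "q < d * m" using Y by auto
  \<comment> \<open>Positivity of \<open>m\<close> guarantees that the remainder
    \<open>p mod m\<close> is a valid second label.\<close>
  then have "0 < m" by (cases m) auto
  then show "X $$ (p, q) = Y $$ (p, q)"
    using eq[of "p div m" "q div m" "p mod m" "q mod m"] pq
    by (simp add: less_mult_imp_div_less)
qed (use X Y in auto)

lemma sum_pair_index:
  fixes f :: "nat \<Rightarrow> 'a :: comm_monoid_add"
  shows "(\<Sum>k<d * m. f k) = (\<Sum>i<d. \<Sum>a<m. f (i * m + a))"
proof -
  have "(\<Sum>a = i * m..<i * m + m. f a) = (\<Sum>a<m. f (i * m + a))" for i
    using sum.shift_bounds_nat_ivl[of f 0 "i * m" m] by (simp add: lessThan_atLeast0 add.commute)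
  then show ?thesis by (simp flip: sum.nat_group)
qed

section \<open>Powers and exponential of a Kronecker sum\<close>

text \<open>Pascal's rule as the induction step of a binomial theorem: \<open>f k\<close> and
  \<open>g k\<close> stand for fixed entries of the \<open>k\<close>-th powers of two
  matrices.\<close>

lemma binomial_sum_Suc:
  fixes f g :: "nat \<Rightarrow> 'a :: comm_semiring_1"
  shows "(\<Sum>k\<le>n. of_nat (n choose k) * f (Suc k) * g (n - k))
       + (\<Sum>k\<le>n. of_nat (n choose k) * f k * g (Suc (n - k)))
       = (\<Sum>k\<le>Suc n. of_nat (Suc n choose k) * f k * g (Suc n - k))"
proof -
  \<comment> \<open>The added term at \<open>k = Suc n\<close> vanishes because its binomial
    coefficient is zero.\<close>
  have "(\<Sum>k\<le>n. of_nat (n choose k) * f k * g (Suc (n - k)))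
      = (\<Sum>k\<le>Suc n. of_nat (n choose k) * f k * g (Suc n - k))"
    by (simp add: Suc_diff_le binomial_eq_0)
  also have "\<dots> = f 0 * g (Suc n) + (\<Sum>k\<le>n. of_nat (n choose Suc k) * f (Suc k) * g (n - k))"
    by (subst sum.atMost_Suc_shift) simp
  finally show ?thesis
    by (subst sum.atMost_Suc_shift) (simp add: sum.distrib algebra_simps)
qed

text \<open>This is the binomial theorem for the commuting matrices
  \<open>tensor_mat A (1\<^sub>m m)\<close> and \<open>tensor_mat (1\<^sub>m d) B\<close>, read off
  entrywise. The column labels vary in the induction because each further factor multiplies from the
  right.\<close>

lemma pow_tensor_sum_index:
  assumes A: "A \<in> carrier_mat d d" and B: "B \<in> carrier_mat m m"
    and ij: "i < d" "j < d" and ab: "a < m" "b < m"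
  defines "M \<equiv> tensor_mat A (1\<^sub>m m) + tensor_mat (1\<^sub>m d) B"
  shows "(M ^\<^sub>m n) $$ (i * m + a, j * m + b)
    = (\<Sum>k\<le>n. of_nat (n choose k) * (A ^\<^sub>m k) $$ (i, j) * (B ^\<^sub>m (n - k)) $$ (a, b))"
  using ij ab
proof (induction n arbitrary: j b)
  case 0
  have "i * m + a = j * m + b \<longleftrightarrow> i = j \<and> a = b"
  proof
    assume eq: "i * m + a = j * m + b"
    have "(i * m + a) div m = i" "(i * m + a) mod m = a" "(j * m + b) div m = j" "(j * m + b) mod m = b"
      using 0 by simp_all
    then show "i = j \<and> a = b" by (simp add: eq)
  qed simp
  then show ?case
    using A B 0 by (simp add: M_def pair_index_less tensor_mat_def)
next
  case (Suc n)
  have Mc: "M \<in> carrier_mat (d * m) (d * m)" using A B by (simp add: M_def)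
  have Mi: "M $$ (l * m + c, j * m + b)
      = (if c = b then A $$ (l, j) else 0) + (if l = j then B $$ (c, b) else 0)"
    if "l < d" "c < m" for l c
    using that Suc.prems
    by (simp add: M_def pair_index_less carrier_matD[OF tensor_mat_carrier[OF one_carrier_mat B]]
        tensor_mat_index[OF A one_carrier_mat] tensor_mat_index[OF one_carrier_mat B])
  have "(M ^\<^sub>m Suc n) $$ (i * m + a, j * m + b)
      = (\<Sum>k<d * m. (M ^\<^sub>m n) $$ (i * m + a, k) * M $$ (k, j * m + b))"
    using Mc Suc.prems by (simp add: scalar_prod_def lessThan_atLeast0 pair_index_less)
  also have "\<dots> = (\<Sum>l<d. \<Sum>c<m. (M ^\<^sub>m n) $$ (i * m + a, l * m + c) * M $$ (l * m + c, j * m + b))"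
    by (rule sum_pair_index)
  also have "\<dots> = (\<Sum>l<d. \<Sum>c<m.
        (if c = b then (M ^\<^sub>m n) $$ (i * m + a, l * m + c) * A $$ (l, j) else 0)
      + (if l = j then (M ^\<^sub>m n) $$ (i * m + a, l * m + c) * B $$ (c, b) else 0))"
    by (intro sum.cong refl) (simp add: Mi distrib_left)
  \<comment> \<open>The identity factors act as Kronecker deltas: the first summand keeps only
    \<open>c = b\<close>, the second only \<open>l = j\<close>. They then raise the power of
    \<open>A\<close> and of \<open>B\<close> respectively by one.\<close>
  also have "\<dots> = (\<Sum>l<d. (M ^\<^sub>m n) $$ (i * m + a, l * m + b) * A $$ (l, j))
      + (\<Sum>c<m. (M ^\<^sub>m n) $$ (i * m + a, j * m + c) * B $$ (c, b))"
    using Suc.prems by (simp add: sum.distrib sum.swap[where A = "{..<d}" and B = "{..<m}"])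
  also have "(\<Sum>l<d. (M ^\<^sub>m n) $$ (i * m + a, l * m + b) * A $$ (l, j))
      = (\<Sum>k\<le>n. of_nat (n choose k) * (A ^\<^sub>m Suc k) $$ (i, j) * (B ^\<^sub>m (n - k)) $$ (a, b))"
  proof -
    have "(\<Sum>l<d. (M ^\<^sub>m n) $$ (i * m + a, l * m + b) * A $$ (l, j))
        = (\<Sum>l<d. \<Sum>k\<le>n. of_nat (n choose k) * ((A ^\<^sub>m k) $$ (i, l) * A $$ (l, j)) * (B ^\<^sub>m (n - k)) $$ (a, b))"
      using Suc by (simp add: sum_distrib_left sum_distrib_right mult_ac)
    also have "\<dots> = (\<Sum>k\<le>n. of_nat (n choose k) * (\<Sum>l<d. (A ^\<^sub>m k) $$ (i, l) * A $$ (l, j)) * (B ^\<^sub>m (n - k)) $$ (a, b))"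
      by (subst sum.swap) (simp add: sum_distrib_right sum_distrib_left)
    also have "(\<lambda>k. \<Sum>l<d. (A ^\<^sub>m k) $$ (i, l) * A $$ (l, j)) = (\<lambda>k. (A ^\<^sub>m Suc k) $$ (i, j))"
      using A Suc.prems by (simp add: scalar_prod_def lessThan_atLeast0)
    finally show ?thesis .
  qed
  also have "(\<Sum>c<m. (M ^\<^sub>m n) $$ (i * m + a, j * m + c) * B $$ (c, b))
      = (\<Sum>k\<le>n. of_nat (n choose k) * (A ^\<^sub>m k) $$ (i, j) * (B ^\<^sub>m Suc (n - k)) $$ (a, b))"
  proof -
    have "(\<Sum>c<m. (M ^\<^sub>m n) $$ (i * m + a, j * m + c) * B $$ (c, b))
        = (\<Sum>c<m. \<Sum>k\<le>n. of_nat (n choose k) * (A ^\<^sub>m k) $$ (i, j) * ((B ^\<^sub>m (n - k)) $$ (a, c) * B $$ (c, b)))"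
      using Suc by (simp add: sum_distrib_left sum_distrib_right mult_ac)
    also have "\<dots> = (\<Sum>k\<le>n. of_nat (n choose k) * (A ^\<^sub>m k) $$ (i, j) * (\<Sum>c<m. (B ^\<^sub>m (n - k)) $$ (a, c) * B $$ (c, b)))"
      by (subst sum.swap) (simp add: sum_distrib_left)
    also have "(\<lambda>k. \<Sum>c<m. (B ^\<^sub>m (n - k)) $$ (a, c) * B $$ (c, b)) = (\<lambda>k. (B ^\<^sub>m Suc (n - k)) $$ (a, b))"
      using B Suc.prems by (simp add: scalar_prod_def lessThan_atLeast0)
    finally show ?thesis .
  qed
  finally show ?case
    using binomial_sum_Suc[of n "\<lambda>k. (A ^\<^sub>m k) $$ (i, j)" "\<lambda>k. (B ^\<^sub>m k) $$ (a, b)"] by simp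
qed

text \<open>The product of an entry of \<open>mat_exp A\<close> and an entry of
  \<open>mat_exp B\<close> is a Cauchy product of series, whose \<open>n\<close>-th term is the
  binomial expansion of the \<open>n\<close>-th power divided by \<open>fact n\<close>.\<close>

lemma mat_exp_tensor_sum:
  assumes A: "A \<in> carrier_mat d d" and B: "B \<in> carrier_mat m m"
  shows "mat_exp (tensor_mat A (1\<^sub>m m) + tensor_mat (1\<^sub>m d) B) = tensor_mat (mat_exp A) (mat_exp B)"
proof (rule tensor_mat_eqI)
  let ?M = "tensor_mat A (1\<^sub>m m) + tensor_mat (1\<^sub>m d) B"
  have M: "?M \<in> carrier_mat (d * m) (d * m)" using A B by simp
  show "mat_exp ?M \<in> carrier_mat (d * m) (d * m)"
    "tensor_mat (mat_exp A) (mat_exp B) \<in> carrier_mat (d * m) (d * m)"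
    using A B M by simp_all
  fix i j a b assume ij: "i < d" "j < d" and ab: "a < m" "b < m"
  have "(\<lambda>n. \<Sum>k\<le>n. (A ^\<^sub>m k) $$ (i, j) / fact k * ((B ^\<^sub>m (n - k)) $$ (a, b) / fact (n - k)))
      sums (mat_exp A $$ (i, j) * mat_exp B $$ (a, b))"
    using Cauchy_product_sums[OF summable_norm_mat_exp[OF A ij] summable_norm_mat_exp[OF B ab]]
      mat_exp_sums[OF A ij] mat_exp_sums[OF B ab] by (simp add: sums_iff)
  moreover have "(\<Sum>k\<le>n. (A ^\<^sub>m k) $$ (i, j) / fact k * ((B ^\<^sub>m (n - k)) $$ (a, b) / fact (n - k)))
      = (?M ^\<^sub>m n) $$ (i * m + a, j * m + b) / fact n" for n
    unfolding pow_tensor_sum_index[OF A B ij ab] sum_divide_distrib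
    by (rule sum.cong) (simp_all add: binomial_fact)
  ultimately have "mat_exp ?M $$ (i * m + a, j * m + b) = mat_exp A $$ (i, j) * mat_exp B $$ (a, b)"
    using mat_exp_sums[OF M pair_index_less[OF ij(1) ab(1)] pair_index_less[OF ij(2) ab(2)]]
    by (simp add: sums_unique2)
  also have "\<dots> = tensor_mat (mat_exp A) (mat_exp B) $$ (i * m + a, j * m + b)"
    by (rule tensor_mat_index[symmetric]) (use A B ij ab in auto)
  finally show "mat_exp ?M $$ (i * m + a, j * m + b)
      = tensor_mat (mat_exp A) (mat_exp B) $$ (i * m + a, j * m + b)" .
qed

section \<open>Bilinearity of the tensor product\<close>

lemma smult_one_mat: "1 \<cdot>\<^sub>m A = (A :: 'a :: semiring_1 mat)"
  by (rule eq_matI) auto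

lemma tensor_mat_smult:
  assumes "A \<in> carrier_mat d d" "B \<in> carrier_mat m m"
  shows "tensor_mat (x \<cdot>\<^sub>m A) (y \<cdot>\<^sub>m B) = (x * y) \<cdot>\<^sub>m tensor_mat A B"
  by (rule tensor_mat_eqI[of _ d m])
    (use assms in \<open>auto simp: tensor_mat_index[of _ d _ m] pair_index_less carrier_matD[OF tensor_mat_carrier]\<close>)

lemma tensor_mat_add_left:
  assumes "A \<in> carrier_mat d d" "A' \<in> carrier_mat d d" "B \<in> carrier_mat m m"
  shows "tensor_mat (A + A') B = tensor_mat A B + tensor_mat A' B"
  by (rule tensor_mat_eqI[of _ d m])
    (use assms in \<open>auto simp: tensor_mat_index[of _ d _ m] pair_index_less carrier_matD[OF tensor_mat_carrier]
      distrib_right\<close>)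

section \<open>Thermal operations\<close>

lemma gibbs_state_carrier [simp]: "H \<in> carrier_mat n n \<Longrightarrow> gibbs_state \<beta> H \<in> carrier_mat n n"
  by (simp add: gibbs_state_def Let_def)

lemma mat_adjoint_carrier: "U \<in> carrier_mat n n \<Longrightarrow> mat_adjoint U \<in> carrier_mat n n"
  unfolding mat_adjoint_def by (intro carrier_matI) auto

text \<open>Attaching the fixed bath state, multiplying by \<open>U\<close> and its adjoint, and
  tracing out the bath are each linear. \<open>F\<close> collects everything before the partial
  trace.\<close>

lemma thermal_operation_linear:
  assumes "thermal_operation d \<beta> H \<Phi>"
  shows "linear_mat_map d \<Phi>"
proof -
  obtain m H\<^sub>B U where HB: "H\<^sub>B \<in> carrier_mat m m" and U: "U \<in> carrier_mat (d * m) (d * m)"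
    and \<Phi>: "\<And>\<rho>. \<rho> \<in> carrier_mat d d \<Longrightarrow> \<Phi> \<rho> =
      partial_trace_snd d m (U * tensor_mat \<rho> (gibbs_state \<beta> H\<^sub>B) * mat_adjoint U)"
    using assms by (auto simp: thermal_operation_def hermitian_mat_def unitary_mat_def)
  define \<tau> where "\<tau> = gibbs_state \<beta> H\<^sub>B"
  have \<tau>: "\<tau> \<in> carrier_mat m m" using HB by (simp add: \<tau>_def)
  define F where "F \<rho> = U * tensor_mat \<rho> \<tau> * mat_adjoint U" for \<rho>
  note U' = mat_adjoint_carrier[OF U]
  have F: "F X \<in> carrier_mat (d * m) (d * m)" if "X \<in> carrier_mat d d" for X
    using that U U' \<tau> unfolding F_def by (meson mult_carrier_mat tensor_mat_carrier)
  have \<Phi>F: "\<Phi> X = partial_trace_snd d m (F X)" if "X \<in> carrier_mat d d" for X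
    using \<Phi> that by (simp add: F_def \<tau>_def)
  have add: "F (X + Y) = F X + F Y" if "X \<in> carrier_mat d d" "Y \<in> carrier_mat d d" for X Y
  proof -
    note X = tensor_mat_carrier[OF that(1) \<tau>] and Y = tensor_mat_carrier[OF that(2) \<tau>]
    show ?thesis
      unfolding F_def tensor_mat_add_left[OF that \<tau>] mult_add_distrib_mat[OF U X Y]
      by (rule add_mult_distrib_mat[OF mult_carrier_mat[OF U X] mult_carrier_mat[OF U Y] U'])
  qed
  have smult: "F (c \<cdot>\<^sub>m X) = c \<cdot>\<^sub>m F X" if "X \<in> carrier_mat d d" for c X
  proof -
    note X = tensor_mat_carrier[OF that \<tau>]
    have "tensor_mat (c \<cdot>\<^sub>m X) \<tau> = c \<cdot>\<^sub>m tensor_mat X \<tau>"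
      using tensor_mat_smult[OF that \<tau>, of c 1] by (simp add: smult_one_mat)
    then show ?thesis
      using mult_smult_distrib[OF U X] mult_smult_assoc_mat[OF mult_carrier_mat[OF U X] U']
      by (simp add: F_def)
  qed
  show ?thesis
    unfolding linear_mat_map_def
  proof (intro conjI ballI allI)
    fix X :: "complex mat" assume X: "X \<in> carrier_mat d d"
    show "\<Phi> X \<in> carrier_mat d d" by (simp add: \<Phi>F X partial_trace_snd_def)
    show "\<Phi> (c \<cdot>\<^sub>m X) = c \<cdot>\<^sub>m \<Phi> X" for c
      using F[OF X]
      by (intro eq_matI) (auto simp: \<Phi>F X smult partial_trace_snd_def pair_index_less sum_distrib_left)
    fix Y :: "complex mat" assume Y: "Y \<in> carrier_mat d d"
    show "\<Phi> (X + Y) = \<Phi> X + \<Phi> Y"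
      using F[OF X] F[OF Y]
      by (intro eq_matI) (auto simp: \<Phi>F X Y add partial_trace_snd_def pair_index_less sum.distrib)
  qed
qed

text \<open>The product of the two Gibbs states is a scalar multiple of the exponential of -\<beta>
  times the total Hamiltonian, and \<open>U\<close> commutes with that exponential.\<close>

lemma gibbs_state_tensor_commute:
  assumes A: "A \<in> carrier_mat d d" and B: "B \<in> carrier_mat m m"
    and U: "U \<in> carrier_mat (d * m) (d * m)"
    and comm: "U * (tensor_mat A (1\<^sub>m m) + tensor_mat (1\<^sub>m d) B)
      = (tensor_mat A (1\<^sub>m m) + tensor_mat (1\<^sub>m d) B) * U"
  shows "U * tensor_mat (gibbs_state \<beta> A) (gibbs_state \<beta> B)
    = tensor_mat (gibbs_state \<beta> A) (gibbs_state \<beta> B) * U"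
proof -
  let ?M = "tensor_mat A (1\<^sub>m m) + tensor_mat (1\<^sub>m d) B"
  let ?c = "complex_of_real (- \<beta>)"
  have M: "?M \<in> carrier_mat (d * m) (d * m)" using A B by simp
  have cA: "?c \<cdot>\<^sub>m A \<in> carrier_mat d d" and cB: "?c \<cdot>\<^sub>m B \<in> carrier_mat m m"
    and cM: "?c \<cdot>\<^sub>m ?M \<in> carrier_mat (d * m) (d * m)"
    using A B M by simp_all
  define E where "E = tensor_mat (mat_exp (?c \<cdot>\<^sub>m A)) (mat_exp (?c \<cdot>\<^sub>m B))"
  have E: "E \<in> carrier_mat (d * m) (d * m)" unfolding E_def using cA cB by simp
  have cM_eq: "?c \<cdot>\<^sub>m ?M = tensor_mat (?c \<cdot>\<^sub>m A) (1\<^sub>m m) + tensor_mat (1\<^sub>m d) (?c \<cdot>\<^sub>m B)"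
    using tensor_mat_smult[OF A one_carrier_mat, where x = ?c and y = 1] tensor_mat_smult[OF one_carrier_mat B, where x = 1 and y = ?c]
      add_smult_distrib_left_mat[OF tensor_mat_carrier[OF A one_carrier_mat]
        tensor_mat_carrier[OF one_carrier_mat B]]
    by (simp add: smult_one_mat)
  have "U * (?c \<cdot>\<^sub>m ?M) = (?c \<cdot>\<^sub>m ?M) * U"
    by (simp only: mult_smult_distrib[OF U M] mult_smult_assoc_mat[OF M U] comm)
  from mat_exp_commute[OF cM U this] have "U * E = E * U"
    unfolding cM_eq mat_exp_tensor_sum[OF cA cB] E_def .
  \<comment> \<open>Here \<open>z\<close> is the product of the two normalisation factors.\<close>
  moreover obtain z where "tensor_mat (gibbs_state \<beta> A) (gibbs_state \<beta> B) = z \<cdot>\<^sub>m E"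
    unfolding gibbs_state_def Let_def E_def
    using tensor_mat_smult[OF mat_exp_carrier[OF cA] mat_exp_carrier[OF cB]] by blast
  ultimately show ?thesis
    by (simp only: mult_smult_distrib[OF U E] mult_smult_assoc_mat[OF E U])
qed

lemma partial_trace_snd_tensor:
  assumes "A \<in> carrier_mat d d" "B \<in> carrier_mat m m"
  shows "partial_trace_snd d m (tensor_mat A B) = mat_trace B \<cdot>\<^sub>m A"
  using assms
  by (intro eq_matI)
    (auto simp: partial_trace_snd_def tensor_mat_index mat_trace_def sum_distrib_left mult.commute)

text \<open>
  The factor is the trace of \<open>\<tau>\<^sub>B\<close>. Only proportionality is needed, so there is no need to show
  that the partition function is nonzero.
\<close>

lemma thermal_operation_gibbs_state:
  assumes H: "H \<in> carrier_mat d d" and thermal: "thermal_operation d \<beta> H \<Phi>"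
  shows "\<exists>c::complex. \<Phi> (gibbs_state \<beta> H) = c \<cdot>\<^sub>m gibbs_state \<beta> H"
proof -
  obtain m H\<^sub>B U where HB: "H\<^sub>B \<in> carrier_mat m m" and U: "unitary_mat (d * m) U"
    and comm: "U * (tensor_mat H (1\<^sub>m m) + tensor_mat (1\<^sub>m d) H\<^sub>B)
      = (tensor_mat H (1\<^sub>m m) + tensor_mat (1\<^sub>m d) H\<^sub>B) * U"
    and \<Phi>: "\<And>\<rho>. \<rho> \<in> carrier_mat d d \<Longrightarrow> \<Phi> \<rho> =
      partial_trace_snd d m (U * tensor_mat \<rho> (gibbs_state \<beta> H\<^sub>B) * mat_adjoint U)"
    using thermal by (auto simp: thermal_operation_def hermitian_mat_def Let_def)
  have U': "U \<in> carrier_mat (d * m) (d * m)" "U * mat_adjoint U = 1\<^sub>m (d * m)"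
    using U by (simp_all add: unitary_mat_def)
  define T where "T = tensor_mat (gibbs_state \<beta> H) (gibbs_state \<beta> H\<^sub>B)"
  have T: "T \<in> carrier_mat (d * m) (d * m)"
    unfolding T_def using H HB by simp
  \<comment> \<open>Moving \<open>U\<close> to the right of \<open>T\<close> brings it next to its
    adjoint, where unitarity cancels the pair.\<close>
  have "U * T * mat_adjoint U = T * (U * mat_adjoint U)"
    using gibbs_state_tensor_commute[OF H HB U'(1) comm]
      assoc_mult_mat[OF T U'(1) mat_adjoint_carrier[OF U'(1)]]
    by (simp add: T_def)
  then have "U * T * mat_adjoint U = T"
    using T by (simp add: U'(2))
  then have "\<Phi> (gibbs_state \<beta> H) = partial_trace_snd d m T"
    using \<Phi> H by (simp add: T_def)
  then show ?thesis
    unfolding T_def using partial_trace_snd_tensor H HB by (metis gibbs_state_carrier)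
qed

section \<open>Coherence bounds and the obstruction to saturating them\<close>

theorem corollary4:
  fixes d r s :: nat and \<gamma> :: "complex mat"
  assumes "r < d" and "s < d" and "r \<noteq> s"
    and "density_mat d \<gamma>" and "diagonal_mat \<gamma>" and "vec_space.rank d \<gamma> = d"
  shows
    "(\<forall>\<Phi>. completely_positive d \<Phi> \<and> \<Phi> \<gamma> = \<gamma> \<longrightarrow>
        (\<forall>i<d. cmod (coherence_q d \<gamma> \<Phi> r s i) \<le> bound_b \<gamma> (trans_prob d \<Phi>) r s i) \<and>
        (\<Sum>i<d. coherence_q d \<gamma> \<Phi> r s i) = 0) \<and>
     (\<forall>p :: nat \<Rightarrow> nat \<Rightarrow> real.
        (\<exists>i\<^sub>0<d. bound_b \<gamma> p r s i\<^sub>0 > (\<Sum>i\<in>{..<d} - {i\<^sub>0}. bound_b \<gamma> p r s i)) \<longrightarrow>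
        \<not> (\<exists>\<Phi>. completely_positive d \<Phi> \<and> \<Phi> \<gamma> = \<gamma> \<and>
               has_trans_probs d p r s \<Phi> \<and> saturates d p r s \<Phi>) \<and>
        (\<forall>(\<beta> :: real) H\<^sub>S.
           hermitian_mat d H\<^sub>S \<and> diagonal_mat H\<^sub>S \<and> \<gamma> = gibbs_state \<beta> H\<^sub>S \<longrightarrow>
           \<not> (\<exists>\<Phi>. covariant_gibbs_preserving d \<beta> H\<^sub>S \<Phi> \<and>
                  has_trans_probs d p r s \<Phi> \<and> saturates d p r s \<Phi>) \<and>
           \<not> (\<exists>\<Phi>. thermal_operation d \<beta> H\<^sub>S \<Phi> \<and>
                  has_trans_probs d p r s \<Phi> \<and> saturates d p r s \<Phi>)))"
proof -
  have psd: "psd_mat d \<gamma>" using \<open>density_mat d \<gamma>\<close> by (simp add: density_mat_def)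
  have c: "\<gamma> \<in> carrier_mat d d" using psd by (simp add: psd_mat_def)
  have off_diag: "\<gamma> $$ (r, s) = 0"
    using c \<open>diagonal_mat \<gamma>\<close> \<open>r < d\<close> \<open>s < d\<close> \<open>r \<noteq> s\<close> by (simp add: diagonal_mat_def)
  have bounds: "cmod (coherence_q d \<gamma> \<Phi> r s i) \<le> bound_b \<gamma> (trans_prob d \<Phi>) r s i"
    if "completely_positive d \<Phi>" "i < d" for \<Phi> i
  proof -
    have "psd_mat d (\<Phi> (ket_bra d i i))"
      by (rule completely_positive_psd_mat[OF that(1) psd_mat_ket_bra[OF that(2)]])
    from psd_mat_entry_bound[OF this \<open>r < d\<close> \<open>s < d\<close> \<open>r \<noteq> s\<close>]
    have "cmod (\<Phi> (ket_bra d i i) $$ (r, s)) \<le> sqrt (trans_prob d \<Phi> r i * trans_prob d \<Phi> s i)"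
      by (simp add: trans_prob_def)
    then show ?thesis
      using psd_mat_diag_nonneg[OF psd that(2)]
      by (auto simp: coherence_q_def bound_b_def norm_mult less_eq_complex_def cmod_eq_Re mult_left_mono)
  qed
  have sum_zero: "(\<Sum>i<d. coherence_q d \<gamma> \<Phi> r s i) = 0"
    if "completely_positive d \<Phi>" "\<Phi> \<gamma> = \<gamma>" for \<Phi>
    using that linear_mat_map_diagonal_entry[OF _ c \<open>diagonal_mat \<gamma>\<close> \<open>r < d\<close> \<open>s < d\<close>] off_diag
    by (simp add: completely_positive_def)
  \<comment> \<open>Linearity and a vanishing (r, s) entry are the common ground of completely
    positive maps fixing \<gamma> and of thermal operations, so both cases below are
    instances.\<close>
  have no_sat: "\<not> saturates d p r s \<Phi>"
    if "\<exists>i\<^sub>0<d. bound_b \<gamma> p r s i\<^sub>0 > (\<Sum>i\<in>{..<d} - {i\<^sub>0}. bound_b \<gamma> p r s i)"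
      and "linear_mat_map d \<Phi>" and "\<Phi> \<gamma> $$ (r, s) = 0" for p \<Phi>
    using that not_saturates_if_dominant_bound[OF that(2) psd \<open>diagonal_mat \<gamma>\<close> \<open>r < d\<close> \<open>s < d\<close> that(3)]
    by blast
  \<comment> \<open>A scalar multiple of the diagonal matrix \<gamma> still has a zero entry at (r,
    s).\<close>
  have thermal: "linear_mat_map d \<Phi> \<and> \<Phi> \<gamma> $$ (r, s) = 0"
    if "thermal_operation d \<beta> H \<Phi>" "hermitian_mat d H" "\<gamma> = gibbs_state \<beta> H" for \<beta> H \<Phi>
  proof -
    have "H \<in> carrier_mat d d" using that(2) by (simp add: hermitian_mat_def)
    from thermal_operation_gibbs_state[OF this that(1)] that(3) obtain z :: complex where "\<Phi> \<gamma> = z \<cdot>\<^sub>m \<gamma>"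
      by auto
    then show ?thesis
      using thermal_operation_linear[OF that(1)] c off_diag \<open>r < d\<close> \<open>s < d\<close> by simp
  qed
  have cp_no_sat: "\<not> saturates d p r s \<Phi>"
    if "\<exists>i\<^sub>0<d. bound_b \<gamma> p r s i\<^sub>0 > (\<Sum>i\<in>{..<d} - {i\<^sub>0}. bound_b \<gamma> p r s i)"
      and "completely_positive d \<Phi>" and "\<Phi> \<gamma> = \<gamma>" for p \<Phi>
    using no_sat[OF that(1)] that(2,3) off_diag by (simp add: completely_positive_def)
  have covariant: "completely_positive d \<Phi> \<and> \<Phi> \<gamma> = \<gamma>"
    if "covariant_gibbs_preserving d \<beta> H \<Phi>" "\<gamma> = gibbs_state \<beta> H" for \<beta> H \<Phi>
    using that by (simp add: covariant_gibbs_preserving_def)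
  show ?thesis
  proof (rule conjI; intro allI impI)
    fix \<Phi> assume "completely_positive d \<Phi> \<and> \<Phi> \<gamma> = \<gamma>"
    then show "(\<forall>i<d. cmod (coherence_q d \<gamma> \<Phi> r s i) \<le> bound_b \<gamma> (trans_prob d \<Phi>) r s i) \<and>
        (\<Sum>i<d. coherence_q d \<gamma> \<Phi> r s i) = 0"
      using bounds sum_zero by blast
  next
    fix p :: "nat \<Rightarrow> nat \<Rightarrow> real"
    assume dominant: "\<exists>i\<^sub>0<d. bound_b \<gamma> p r s i\<^sub>0 > (\<Sum>i\<in>{..<d} - {i\<^sub>0}. bound_b \<gamma> p r s i)"
    note no_sat = no_sat[OF dominant] and cp_no_sat = cp_no_sat[OF dominant]
    show "\<not> (\<exists>\<Phi>. completely_positive d \<Phi> \<and> \<Phi> \<gamma> = \<gamma> \<and>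
               has_trans_probs d p r s \<Phi> \<and> saturates d p r s \<Phi>) \<and>
        (\<forall>(\<beta> :: real) H\<^sub>S.
           hermitian_mat d H\<^sub>S \<and> diagonal_mat H\<^sub>S \<and> \<gamma> = gibbs_state \<beta> H\<^sub>S \<longrightarrow>
           \<not> (\<exists>\<Phi>. covariant_gibbs_preserving d \<beta> H\<^sub>S \<Phi> \<and>
                  has_trans_probs d p r s \<Phi> \<and> saturates d p r s \<Phi>) \<and>
           \<not> (\<exists>\<Phi>. thermal_operation d \<beta> H\<^sub>S \<Phi> \<and>
                  has_trans_probs d p r s \<Phi> \<and> saturates d p r s \<Phi>))"
      using no_sat cp_no_sat covariant thermal by blast
  qed
qed

end
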